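(* Let $\Omega\subset\mathbb{R}^2$ be a compact domain with smooth boundary. Let $\Phi\in C^2(\overline{\Omega})$ be such that, for some functions $G$ and $R$ of one real variable, $$|\nabla\Phi|^2=G(\Phi),\qquad \Delta\Phi=R(\Phi)\qquad\text{for } x\in\Omega$$ in the classical sense, with boundary conditions $$\Phi|_{\partial\Omega}=0,\qquad \nabla\Phi|_{\partial\Omega}=0.$$ Let ${\bf u}$ be the velocity field of the local field generated by $\Phi$ (equal to $\nabla_\bot\Phi$ in $\Omega$ and to $0$ in $\mathbb{R}^2\setminus\Omega$), and let $\pi_1(t,{\bf x})$, $t\ge 0$, ${\bf x}\in\mathbb{R}^2$, be the solution of $$\partial_t\pi_1+(\nabla\pi_1\cdot{\bf u})+\pi_1\,{\rm div}\,{\bf u}=0$$ with a given initial datum $\pi_1(0,{\bf x})$. Then in the domain $\mathbb{R}^2\setminus\Omega$ the solution $\pi_1$ does not depend on the local field. That is, if $\Phi,\widetilde\Phi\in C^2(\overline{\Omega})$ are two functions satisfying, in the classical sense for $x\in\Omega$, $|\nabla\Phi|^2=G(\Phi)$, $\Delta\Phi=R(\Phi)$ and $|\nabla\widetilde\Phi|^2=\widetilde G(\widetilde\Phi)$, $\Delta\widetilde\Phi=\widetilde R(\widetilde\Phi)$ respectively (each with its own pair of functions $G,R$ and $\widetilde G,\widetilde R$ of one real variable), with boundary conditions $\Phi|_{\partial\Omega}=\widetilde\Phi|_{\partial\Omega}=0$ and $\nabla\Phi|_{\partial\Omega}=\nabla\widetilde\Phi|_{\partial\Omega}=0$, with corresponding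 velocity fields ${\bf u},\widetilde{\bf u}$ (equal to $\nabla_\bot\Phi$, respectively $\nabla_\bot\widetilde\Phi$, in $\Omega$ and to $0$ in $\mathbb{R}^2\setminus\Omega$), and if $\pi_1,\widetilde\pi_1$ are the corresponding solutions of $\partial_t\pi_1+(\nabla\pi_1\cdot{\bf u})+\pi_1\,{\rm div}\,{\bf u}=0$ and $\partial_t\widetilde\pi_1+(\nabla\widetilde\pi_1\cdot\widetilde{\bf u})+\widetilde\pi_1\,{\rm div}\,\widetilde{\bf u}=0$ with the same initial datum, then $\pi_1(t,{\bf x})=\widetilde\pi_1(t,{\bf x})$ for all $t\ge0$ and ${\bf x}\in\mathbb{R}^2\setminus\Omega$.
   Context: Notation: $\nabla_\bot\Phi=(\Phi_{x_2},-\Phi_{x_1})$. The coordinates ${\bf x}=(x_1,x_2)$ are those of the local (moving) coordinate system. The function $\Phi$ is the stream function of a steady divergence-free velocity field ${\bf u}=\nabla_\bot\Phi$ (the velocity of the "local field"); since $\nabla\Phi=0$ on $\partial\Omega$, ${\bf u}$ vanishes on $\partial\Omega$ and is extended by zero to all of $\mathbb{R}^2$. The function $\pi_1$ is the pressure part of the "bearing field"; solutions of its transport equation are understood as classical, i.e. continuously differentiable, solutions. *)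

theory Defs
  imports "HOL-Analysis.Analysis"
begin

definition partial_deriv :: "2 \<Rightarrow> (real^2 \<Rightarrow> real) \<Rightarrow> real^2 \<Rightarrow> real" where
  "partial_deriv i f x = frechet_derivative f (at x) (axis i 1)"

definition grad :: "(real^2 \<Rightarrow> real) \<Rightarrow> real^2 \<Rightarrow> real^2" where
  "grad f x = (\<chi> i. partial_deriv i f x)"

definition perp_grad :: "(real^2 \<Rightarrow> real) \<Rightarrow> real^2 \<Rightarrow> real^2" where
  "perp_grad f x = vector [partial_deriv 2 f x, - partial_deriv 1 f x]"

definition laplacian :: "(real^2 \<Rightarrow> real) \<Rightarrow> real^2 \<Rightarrow> real" where
  "laplacian f x = (\<Sum>i\<in>UNIV. partial_deriv i (partial_deriv i f) x)"

definition divergence :: "(real^2 \<Rightarrow> real^2) \<Rightarrow> real^2 \<Rightarrow> real" where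
  "divergence u x = (\<Sum>i\<in>UNIV. partial_deriv i (\<lambda>y. u y $ i) x)"

text \<open>Intended for open sets.\<close>

fun Ck_on :: "nat \<Rightarrow> (real^2 \<Rightarrow> real) \<Rightarrow> (real^2) set \<Rightarrow> bool" where
  "Ck_on 0 f U \<longleftrightarrow> continuous_on U f"
| "Ck_on (Suc k) f U \<longleftrightarrow>
     (\<forall>x\<in>U. f differentiable (at x)) \<and> (\<forall>i. Ck_on k (partial_deriv i f) U)"

definition smooth_on :: "(real^2 \<Rightarrow> real) \<Rightarrow> (real^2) set \<Rightarrow> bool" where
  "smooth_on f U \<longleftrightarrow> (\<forall>k. Ck_on k f U)"

text \<open>
  Smoothness of the boundary of a closed set: near every boundary point the set is a
  sublevel set of a smooth function without critical points. In particular the set lies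
  locally on one side of its boundary, and a closed set of this kind is the closure of
  its interior.
\<close>

definition smooth_boundary :: "(real^2) set \<Rightarrow> bool" where
  "smooth_boundary \<Omega> \<longleftrightarrow>
     (\<forall>p\<in>frontier \<Omega>. \<exists>U \<rho>. open U \<and> p \<in> U \<and> smooth_on \<rho> U \<and>
        (\<forall>x\<in>U. grad \<rho> x \<noteq> 0) \<and> \<Omega> \<inter> U = {x \<in> U. \<rho> x \<le> 0})"

text \<open>
  The domain is taken with its boundary, so \<open>\<Omega>\<close> is its own closure and the underlying
  open connected set is \<open>interior \<Omega>\<close>.
\<close>

definition compact_smooth_domain :: "(real^2) set \<Rightarrow> bool" where
  "compact_smooth_domain \<Omega> \<longleftrightarrow>
     compact \<Omega> \<and> interior \<Omega> \<noteq> {} \<and> connected (interior \<Omega>) \<and> smooth_boundary \<Omega>"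

definition extends_continuously :: "(real^2) set \<Rightarrow> (real^2 \<Rightarrow> real) \<Rightarrow> bool" where
  "extends_continuously \<Omega> f \<longleftrightarrow>
     (\<exists>g. continuous_on \<Omega> g \<and> (\<forall>x\<in>interior \<Omega>. g x = f x))"

text \<open>
  Twice continuously differentiable up to the boundary: all derivatives of order at most
  two exist in the interior and have continuous extensions to the closed set \<open>\<Omega>\<close>.
\<close>

definition C2_up_to_boundary :: "(real^2) set \<Rightarrow> (real^2 \<Rightarrow> real) \<Rightarrow> bool" where
  "C2_up_to_boundary \<Omega> \<Phi> \<longleftrightarrow>
     continuous_on \<Omega> \<Phi> \<and> Ck_on 2 \<Phi> (interior \<Omega>) \<and>
     (\<forall>i. extends_continuously \<Omega> (partial_deriv i \<Phi>)) \<and>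
     (\<forall>i j. extends_continuously \<Omega> (partial_deriv j (partial_deriv i \<Phi>)))"

text \<open>
  The values of \<open>\<Phi>\<close> outside \<open>\<Omega>\<close> are irrelevant, so the boundary value of its gradient
  is the limit from the interior. The equations are required only at interior points.
\<close>

definition local_stream_function ::
  "(real^2) set \<Rightarrow> (real \<Rightarrow> real) \<Rightarrow> (real \<Rightarrow> real) \<Rightarrow> (real^2 \<Rightarrow> real) \<Rightarrow> bool" where
  "local_stream_function \<Omega> G R \<Phi> \<longleftrightarrow>
     C2_up_to_boundary \<Omega> \<Phi> \<and>
     (\<forall>x\<in>interior \<Omega>. (norm (grad \<Phi> x))\<^sup>2 = G (\<Phi> x) \<and> laplacian \<Phi> x = R (\<Phi> x)) \<and>
     (\<forall>x\<in>frontier \<Omega>. \<Phi> x = 0) \<and>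
     (\<forall>x\<in>frontier \<Omega>. (grad \<Phi> \<longlongrightarrow> 0) (at x within interior \<Omega>))"

text \<open>
  On the frontier the value \<open>0\<close> is also the boundary value of \<open>perp_grad \<Phi>\<close> whenever
  \<open>\<Phi>\<close> is a local stream function.
\<close>

definition local_velocity :: "(real^2) set \<Rightarrow> (real^2 \<Rightarrow> real) \<Rightarrow> real^2 \<Rightarrow> real^2" where
  "local_velocity \<Omega> \<Phi> x = (if x \<in> interior \<Omega> then perp_grad \<Phi> x else 0)"

definition C1_on :: "'a::real_normed_vector set \<Rightarrow> ('a \<Rightarrow> real) \<Rightarrow> bool" where
  "C1_on S f \<longleftrightarrow>
     (\<exists>D :: 'a \<Rightarrow> 'a \<Rightarrow>\<^sub>L real. continuous_on S D \<and>
        (\<forall>p\<in>S. (f has_derivative blinfun_apply (D p)) (at p within S)))"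

text \<open>
  Classical solutions on \<open>[0,\<infinity>) \<times> \<real>\<^sup>2\<close>; the time derivative at \<open>t = 0\<close> is one-sided.
  The zero extension \<open>u\<close> of a local velocity is continuous, but its first derivatives
  may jump across \<open>frontier \<Omega>\<close> (when the second normal derivative of \<open>\<Phi>\<close> does not vanish
  there), so that \<open>divergence u\<close> need not exist classically on this curve. The equation is
  therefore imposed at every point at which \<open>u\<close> is differentiable, which includes all
  points off \<open>frontier \<Omega>\<close>. On the frontier, where \<open>u = 0\<close>, it then holds by continuity
  with the continuous extension \<open>0\<close> of \<open>divergence u\<close>.
\<close>

definition transport_solution ::
  "(real^2 \<Rightarrow> real^2) \<Rightarrow> (real^2 \<Rightarrow> real) \<Rightarrow> (real \<Rightarrow> real^2 \<Rightarrow> real) \<Rightarrow> bool" where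
  "transport_solution u p0 p \<longleftrightarrow>
     C1_on ({0..} \<times> UNIV) (\<lambda>(t, x). p t x) \<and>
     (\<forall>t\<ge>0. \<forall>x. u differentiable (at x) \<longrightarrow>
        vector_derivative (\<lambda>s. p s x) (at t within {0..}) + grad (p t) x \<bullet> u x
          + p t x * divergence u x = 0) \<and>
     (\<forall>x. p 0 x = p0 x)"

end

theory Submission
  imports Defs
begin

text \<open>Outside \<Omega> nothing moves. The complement of \<Omega> is open and the velocity is
  zero on it, so near each of its points the velocity vanishes together with its divergence, and the
  transport equation reduces to a vanishing time derivative. Hence the solution keeps its initial
  value there, whatever the field does inside \<Omega>; two solutions with the same datum agree.
  This is \<open>transport_solution_stationary\<close>, applied to both fields.\<close>

lemma divergence_vanishing_near:
  assumes "open S" "x \<in> S" "\<And>y. y \<in> S \<Longrightarrow> u y = 0"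
  shows "divergence u x = 0"
proof -
  have "((\<lambda>y. u y $ i) has_derivative (\<lambda>_. 0)) (at x)" for i
    by (rule has_derivative_transform_within_open[of "\<lambda>_. 0" _ _ _ S]) (use assms in auto)
  then have "frechet_derivative (\<lambda>y. u y $ i) (at x) = (\<lambda>_. 0)" for i
    by (metis frechet_derivative_at)
  then show ?thesis
    by (simp add: divergence_def partial_deriv_def)
qed

text \<open>An equation for \<open>vector_derivative\<close> says something about the function only
  once differentiability in time is known. It follows by the chain rule along the line
  \<open>s \<mapsto> (s, x)\<close>, one-sidedly at time 0.\<close>

lemma C1_on_time_slice_differentiable:
  fixes p :: "real \<Rightarrow> 'a::real_normed_vector \<Rightarrow> real"
  assumes "C1_on ({0..} \<times> UNIV) (\<lambda>(t, x). p t x)" "t \<ge> 0"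
  shows "(\<lambda>s. p s x) differentiable (at t within {0..})"
proof -
  obtain D where D: "((\<lambda>(t, x). p t x) has_derivative D) (at (t, x) within {0..} \<times> UNIV)"
    using assms unfolding C1_on_def by fastforce
  have "((\<lambda>s. (s, x)) has_derivative (\<lambda>h. (h, 0))) (at t within {0..})"
    by (auto intro!: derivative_eq_intros)
  moreover have "((\<lambda>(t, x). p t x) has_derivative D) (at (t, x) within (\<lambda>s. (s, x)) ` {0..})"
    by (rule has_derivative_subset[OF D]) auto
  ultimately have "((\<lambda>(t, x). p t x) \<circ> (\<lambda>s. (s, x)) has_derivative D \<circ> (\<lambda>h. (h, 0)))
      (at t within {0..})"
    by (rule diff_chain_within)
  then show ?thesis
    unfolding differentiable_def by (auto simp: o_def)
qed

lemma transport_solution_stationary: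
  assumes "transport_solution u p0 p" "open S" "x \<in> S" "\<And>y. y \<in> S \<Longrightarrow> u y = 0" "t \<ge> 0"
  shows "p t x = p0 x"
proof -
  \<comment> \<open>The equation is imposed only where \<open>u\<close> is differentiable, so this
    must be secured at \<open>x\<close> before it can be used.\<close>
  have "(u has_derivative (\<lambda>_. 0)) (at x)"
    by (rule has_derivative_transform_within_open[of "\<lambda>_. 0" _ _ _ S]) (use assms in auto)
  then have "u differentiable (at x)"
    unfolding differentiable_def by blast
  moreover have "divergence u x = 0" "u x = 0"
    using assms divergence_vanishing_near by blast+
  ultimately have "vector_derivative (\<lambda>s. p s x) (at s within {0..}) = 0" if "s \<ge> 0" for s
    using assms(1) that unfolding transport_solution_def by fastforce
  moreover have "(\<lambda>s. p s x) differentiable (at s within {0..})" if "s \<ge> 0" for s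
    using assms(1) that C1_on_time_slice_differentiable unfolding transport_solution_def by blast
  ultimately have "((\<lambda>s. p s x) has_vector_derivative 0) (at s within {0..})" if "s \<in> {0..}" for s
    using that by (metis atLeast_iff vector_derivative_works)
  \<comment> \<open>The half-line of times is convex, so a zero derivative on it forces a constant,
    which the value at time 0 identifies.\<close>
  then obtain c where "\<And>s. s \<in> {0..} \<Longrightarrow> p s x = c"
    using has_vector_derivative_zero_constant[of "{0..}" "\<lambda>s. p s x"] by auto
  then have "p t x = p 0 x"
    using \<open>t \<ge> 0\<close> by simp
  then show ?thesis
    using assms(1) unfolding transport_solution_def by simp
qed

theorem proposition4p1:
  fixes \<Omega> :: "(real^2) set"
    and \<Phi> \<Phi>' :: "real^2 \<Rightarrow> real"
    and G R G' R' :: "real \<Rightarrow> real"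
    and \<pi>\<^sub>1 \<pi>\<^sub>1' :: "real \<Rightarrow> real^2 \<Rightarrow> real"
    and \<pi>\<^sub>0 :: "real^2 \<Rightarrow> real"
  assumes "compact_smooth_domain \<Omega>"
    and "local_stream_function \<Omega> G R \<Phi>"
    and "local_stream_function \<Omega> G' R' \<Phi>'"
    and "transport_solution (local_velocity \<Omega> \<Phi>) \<pi>\<^sub>0 \<pi>\<^sub>1"
    and "transport_solution (local_velocity \<Omega> \<Phi>') \<pi>\<^sub>0 \<pi>\<^sub>1'"
  shows "\<forall>t\<ge>0. \<forall>x\<in>- \<Omega>. \<pi>\<^sub>1 t x = \<pi>\<^sub>1' t x"
proof (intro allI impI ballI)
  fix t :: real and x :: "real^2"
  assume "t \<ge> 0" "x \<in> - \<Omega>"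
  have "open (- \<Omega>)"
    using assms(1) unfolding compact_smooth_domain_def by (simp add: compact_imp_closed open_Compl)
  \<comment> \<open>Stated for an arbitrary \<open>\<Psi>\<close> so that it serves both stream
    functions.\<close>
  moreover have "local_velocity \<Omega> \<Psi> y = 0" if "y \<in> - \<Omega>" for \<Psi> y
    using that interior_subset[of \<Omega>] by (auto simp: local_velocity_def)
  ultimately have "\<pi>\<^sub>1 t x = \<pi>\<^sub>0 x" "\<pi>\<^sub>1' t x = \<pi>\<^sub>0 x"
    using transport_solution_stationary \<open>t \<ge> 0\<close> \<open>x \<in> - \<Omega>\<close> assms(4,5) by blast+
  then show "\<pi>\<^sub>1 t x = \<pi>\<^sub>1' t x"
    by simp
qed

end
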